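(* For all integers $n\ge 0$ and $\alpha>0$, $$v_0(2^{2\alpha+2}n)\equiv \begin{cases}1 \pmod{2^{3\alpha+2}}, & \text{if } n=k^2 \text{ for some integer } k,\\ 0 \pmod{2^{3\alpha+2}}, & \text{otherwise.}\end{cases}$$
   Context: The integer sequence $v_0(n)$, $n\ge 0$, is defined by the generating function (formal power series in $q$) $$\sum_{n=0}^\infty v_0(n)q^n=\sum_{n=0}^\infty \frac{q^{n^2}(-q;q^2)_n}{(q;q^2)_n},$$ where $(a;q)_0=1$ and $(a;q)_n=\prod_{i=1}^n(1-aq^{i-1})$ for $n\ge1$, so that $(-q;q^2)_n=\prod_{i=1}^n(1+q^{2i-1})$ and $(q;q^2)_n=\prod_{i=1}^n(1-q^{2i-1})$. *)

theory Defs
  imports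
    "HOL-Number_Theory.Cong"
    "HOL-Computational_Algebra.Formal_Power_Series"
begin

definition qpochhammer :: "'a :: comm_ring_1 \<Rightarrow> 'a \<Rightarrow> nat \<Rightarrow> 'a"
  where "qpochhammer a q n = (\<Prod>i=1..n. 1 - a * q ^ (i - 1))"

text \<open>
  Everything lives in the ring of formal power series with integer coefficients, with
  \<open>fps_X\<close> in the role of \<open>q\<close>. The type \<open>int fps\<close> has no division, so the reciprocal of the
  denominator is \<open>fps_right_inverse _ 1\<close>; the argument \<open>1\<close> is the constant coefficient of the
  inverse. The denominator has constant coefficient \<open>1\<close>, and \<open>denominator_inverse\<close> shows that
  this is its genuine (hence unique) inverse.
\<close>

definition v0_summand :: "nat \<Rightarrow> int fps"
  where "v0_summand n =
    fps_X ^ (n ^ 2) * qpochhammer (- fps_X) (fps_X ^ 2) n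
      * fps_right_inverse (qpochhammer fps_X (fps_X ^ 2) n) 1"

text \<open>
  The infinite sum is taken in the library's metric topology on formal power series, that is,
  coefficientwise; \<open>v0_summand_sums\<close> shows that it converges.
\<close>

definition v0 :: "nat \<Rightarrow> int"
  where "v0 n = fps_nth (\<Sum>m. v0_summand m) n"

lemma denominator_inverse:
  "qpochhammer fps_X (fps_X ^ 2) n * fps_right_inverse (qpochhammer fps_X (fps_X ^ 2) n) 1
     = (1 :: int fps)"
proof (rule fps_right_inverse)
  show "fps_nth (qpochhammer fps_X (fps_X ^ 2) n) 0 * 1 = (1 :: int)"
    by (simp add: qpochhammer_def fps_prod_nth' fps_nth_power_0)
qed

lemma v0_summand_nth_eq_0:
  assumes "k < m"
  shows "fps_nth (v0_summand m) k = 0"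
proof -
  have "k < m ^ 2"
    using assms by (metis le_square order_less_le_trans power2_eq_square)
  thus ?thesis
    by (simp add: v0_summand_def mult.assoc fps_X_power_mult_nth)
qed

lemma v0_summand_sums: "v0_summand sums Abs_fps v0"
proof -
  have "v0_summand sums Abs_fps (\<lambda>k. \<Sum>m\<le>k. fps_nth (v0_summand m) k)"
    unfolding sums_def tendsto_fps_iff
  proof
    fix k
    show "\<forall>\<^sub>F N in sequentially. fps_nth (\<Sum>m<N. v0_summand m) k =
            fps_nth (Abs_fps (\<lambda>k. \<Sum>m\<le>k. fps_nth (v0_summand m) k)) k"
      using eventually_gt_at_top[of k]
    proof eventually_elim
      case (elim N)
      have "(\<Sum>m<N. fps_nth (v0_summand m) k) = (\<Sum>m\<le>k. fps_nth (v0_summand m) k)"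
        using elim by (intro sum.mono_neutral_right) (auto simp: v0_summand_nth_eq_0)
      thus ?case
        by (simp add: fps_sum_nth)
    qed
  qed
  moreover from this have "(\<Sum>m. v0_summand m) = Abs_fps v0"
    by (simp add: v0_def fps_eq_iff)
  ultimately show ?thesis
    by (metis sums_iff)
qed

end

theory Submission
  imports Defs Complex_Main "HOL-Computational_Algebra.Formal_Laurent_Series"
begin

text \<open>
  Write \<open>\<phi>(q) = \<Sum>n\<in>\<int>. q^(n^2)\<close>. The bilateral sum
  \<open>F(c) = \<Sum>n\<in>\<int>. q^(n^2-n) (c+q^2)\<dots>(c+q^(2n)) / ((1-c)(1-cq^2)\<dots>(1-cq^(2n-2)))\<close> telescopes to
  \<open>(1-c^2) F(c) = (1+c^2) F(cq^2)\<close>. Hence \<open>F(c) F(ic)\<close> does not change under \<open>c \<mapsto> cq^2\<close> and so equals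
  \<open>F(0)^2 = \<phi>(q^2)^2\<close>. At \<open>c = q\<close> the first factor is \<open>v(q) + v(-q) - 1\<close>, where \<open>v\<close> is the generating
  function of \<open>v0\<close>, and the second is \<open>\<phi>(-q^4)\<close>. Taking the even part twice gives
  \<open>2 (\<Sum>n. v0(4n) q^n) - 1 = \<phi>(q)^2 / \<phi>(-q)\<close>.

  Let \<open>U\<close> extract the coefficients of even index. With \<open>\<nu> = \<phi>(q)/\<phi>(-q) - 1\<close>,
  \<open>\<sigma> = 2 (\<phi>(q)^2 - \<phi>(q^2)^2) / \<phi>(-q)^2\<close> and \<open>\<omega> = 4 (\<phi>(q)^4/\<phi>(-q)^4 - 1)\<close> one has
  \<open>\<nu>^2 = 2 \<sigma>(q^2) (1 + \<nu>)\<close>, \<open>\<sigma>^2 = \<omega>(q^2) (1 + \<sigma>)\<close>, \<open>U \<phi> = \<phi>(q^2)\<close>, \<open>U (\<phi> \<nu>) = 2 \<sigma> \<phi>(q^2)\<close> and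
  \<open>2 U \<sigma> = \<omega>\<close>. Since \<open>\<omega>\<close> lies in \<open>16 \<int>[\<sigma>(q^2), \<nu>]\<close>, it follows that \<open>U\<^sup>2\<close> maps \<open>\<phi> \<omega> \<int>[\<omega>]\<close> into
  \<open>8 \<phi> \<omega> \<int>[\<omega>]\<close>, while it fixes \<open>\<phi>\<close> and sends \<open>\<phi>^2/\<phi>(-q)\<close> to \<open>\<phi> (1 + \<omega>)\<close>. As 64 divides \<open>\<omega>\<close>, each
  further application of \<open>U\<^sup>2\<close> improves the congruence with \<open>\<phi>\<close> modulo 64 by a factor 8.
\<close>

subsection \<open>Dissections and the theta function\<close>

definition dilate :: "'a::idom fps \<Rightarrow> 'a fps"
  where "dilate f = f oo fps_X ^ 2"

definition reflect :: "'a::idom fps \<Rightarrow> 'a fps"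
  where "reflect f = f oo - fps_X"

definition bisect :: "'a::idom fps \<Rightarrow> 'a fps"
  where "bisect f = Abs_fps (\<lambda>n. f $ (2 * n))"

lemma dilate_nth: "dilate f $ n = (if even n then f $ (n div 2) else 0)"
  by (simp add: dilate_def fps_nth_compose_X_power)

lemma reflect_nth: "reflect f $ n = (- 1) ^ n * f $ n"
  by (simp add: reflect_def fps_compose_uminus')

lemma bisect_nth [simp]: "bisect f $ n = f $ (2 * n)"
  by (simp add: bisect_def)

lemma dilate_ring_hom [simp]:
  "dilate (f * g) = dilate f * dilate g" "dilate (f + g) = dilate f + dilate g"
  "dilate (f - g) = dilate f - dilate g" "dilate (f ^ n) = dilate f ^ n"
  "dilate 1 = 1" "dilate 0 = 0" "dilate (numeral k) = numeral k"
  by (simp_all add: dilate_def fps_compose_mult_distrib fps_compose_add_distrib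
      fps_compose_sub_distrib fps_compose_power)

lemma reflect_ring_hom [simp]:
  "reflect (f * g) = reflect f * reflect g" "reflect (f + g) = reflect f + reflect g"
  "reflect (f - g) = reflect f - reflect g" "reflect (f ^ n) = reflect f ^ n"
  "reflect 1 = 1" "reflect (numeral k) = numeral k"
  by (simp_all add: reflect_def fps_compose_mult_distrib fps_compose_add_distrib
      fps_compose_sub_distrib fps_compose_power)

lemma dilate_X: "dilate fps_X = fps_X ^ 2"
  by (simp add: dilate_def)

lemma reflect_X: "reflect fps_X = - fps_X"
  by (simp add: reflect_def)

lemma dilate_sum: "dilate (sum f A) = (\<Sum>x\<in>A. dilate (f x))"
  by (simp add: dilate_def fps_compose_sum_distrib)

lemma reflect_sum: "reflect (sum f A) = (\<Sum>x\<in>A. reflect (f x))"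
  by (simp add: reflect_def fps_compose_sum_distrib)

lemma reflect_reflect [simp]: "reflect (reflect f) = f"
  by (simp add: fps_eq_iff reflect_nth flip: mult.assoc power_mult_distrib)

lemma reflect_dilate [simp]: "reflect (dilate f) = dilate f"
  by (simp add: fps_eq_iff reflect_nth dilate_nth)

lemma bisect_dilate [simp]: "bisect (dilate f) = f"
  by (simp add: fps_eq_iff dilate_nth)

lemma dilate_inject: "dilate f = dilate g \<Longrightarrow> f = g"
  by (metis bisect_dilate)

lemma bisect_ring [simp]:
  "bisect (f + g) = bisect f + bisect g" "bisect (f - g) = bisect f - bisect g"
  "bisect (numeral k * f) = numeral k * bisect f" "bisect (numeral k ^ j * f) = numeral k ^ j * bisect f"
  by (simp_all add: fps_eq_iff numeral_fps_const fps_const_power)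

text \<open>Symmetrising under \<open>q -> -q\<close> kills the odd coefficients and doubles the
  even ones; in characteristic 0 the factor 2 can be cancelled. Most bisections below are computed
  this way.\<close>

lemma even_part:
  fixes f :: "'a :: {idom, ring_char_0} fps"
  assumes "f + reflect f = 2 * dilate g"
  shows "bisect f = g"
proof (rule fps_ext)
  fix n
  from assms have "(f + reflect f) $ (2 * n) = (2 * dilate g) $ (2 * n)"
    by simp
  thus "bisect f $ n = g $ n"
    by (simp add: reflect_nth dilate_nth numeral_fps_const)
qed

lemma even_part':
  fixes f :: "'a :: {idom, ring_char_0} fps"
  shows "f + reflect f = 2 * dilate (bisect f)"
  by (rule fps_ext) (auto simp: reflect_nth dilate_nth numeral_fps_const elim!: evenE oddE)

text \<open>Series in \<open>q^2\<close> are invariant under reflection, so \<open>bisect\<close>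
  treats them as scalars and merely removes their dilation.\<close>

lemma bisect_dilate_mult:
  fixes f :: "'a :: {idom, ring_char_0} fps"
  shows "bisect (dilate f * g) = f * bisect g"
proof (rule even_part)
  have "dilate f * g + reflect (dilate f * g) = dilate f * (g + reflect g)"
    by (simp add: distrib_left)
  also have "\<dots> = 2 * dilate (f * bisect g)"
    by (simp add: even_part')
  finally show "dilate f * g + reflect (dilate f * g) = 2 * dilate (f * bisect g)" .
qed

section \<open>The theta function and its bisections\<close>

text \<open>Counting integer roots weighs 0 once and every other square twice, and makes
  \<open>theta ^ 2\<close> count representations by two squares. The coefficient ring is left open
  because both integer and complex coefficients occur.\<close>

definition theta :: "'a::idom fps"
  where "theta = Abs_fps (\<lambda>n. of_nat (card {k::int. k ^ 2 = int n}))"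

lemma finite_square_roots: "finite {k::int. k ^ 2 = c}"
proof (cases "\<exists>x::int. x ^ 2 = c")
  case True
  then obtain x :: int where "x ^ 2 = c"
    by blast
  hence "{k. k ^ 2 = c} \<subseteq> {x, - x}"
    by (auto simp: power2_eq_iff)
  thus ?thesis
    by (rule finite_subset) simp
qed simp

lemma theta_nth_square: "theta $ (m ^ 2) = (if m = 0 then 1 else 2)"
proof -
  have "{k::int. k ^ 2 = int (m ^ 2)} = {int m, - int m}"
    by (auto simp: power2_eq_iff)
  thus ?thesis
    by (simp add: theta_def card_insert_if)
qed

lemma theta_nth_nonsquare: "\<nexists>m. n = m ^ 2 \<Longrightarrow> theta $ n = 0"
proof -
  assume *: "\<nexists>m. n = m ^ 2"
  have "{k::int. k ^ 2 = int n} = {}"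
    using * by auto (metis nat_abs_mult_distrib nat_int abs_of_nat power2_eq_square)
  thus ?thesis
    by (simp add: theta_def)
qed

lemma theta_nth_0 [simp]: "theta $ 0 = 1"
  using theta_nth_square[of 0] by simp

lemma theta_square_nth:
  "(theta ^ 2) $ n = of_nat (card {(a::int, b::int). a ^ 2 + b ^ 2 = int n})"
proof -
  define A where "A = (\<lambda>n::nat. {k::int. k ^ 2 = int n})"
  have "{(a::int, b::int). a ^ 2 + b ^ 2 = int n} = (\<Union>i\<in>{..n}. A i \<times> A (n - i))"
  proof (intro set_eqI iffI)
    fix x assume "x \<in> {(a::int, b::int). a ^ 2 + b ^ 2 = int n}"
    then obtain a b where x: "x = (a, b)" and *: "a ^ 2 + b ^ 2 = int n"
      by auto
    obtain k l where kl: "a ^ 2 = int k" "b ^ 2 = int l"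
      by (meson zero_le_imp_eq_int zero_le_power2)
    with * have "n = k + l"
      by linarith
    thus "x \<in> (\<Union>i\<in>{..n}. A i \<times> A (n - i))"
      using kl by (auto simp: x A_def intro!: bexI[of _ k])
  qed (auto simp: A_def of_nat_diff)
  moreover have "card (\<Union>i\<in>{..n}. A i \<times> A (n - i)) = (\<Sum>i\<le>n. card (A i) * card (A (n - i)))"
    by (subst card_UN_disjoint) (auto simp: A_def finite_square_roots card_cartesian_product)
  ultimately show ?thesis
    by (simp add: power2_eq_square fps_mult_nth theta_def A_def atMost_atLeast0)
qed

text \<open>The rotation \<open>(u, v) \<mapsto> (u + v, u - v)\<close> doubles \<open>u\<^sup>2 + v\<^sup>2\<close>.\<close>

lemma bisect_theta_square: "bisect (theta ^ 2) = (theta ^ 2 :: 'a::idom fps)"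
proof (rule fps_ext)
  fix n
  let ?rot = "\<lambda>(u::int, v::int). (u + v, u - v)"
  have "{(a, b). a ^ 2 + b ^ 2 = int (2 * n)} = ?rot ` {(a, b). a ^ 2 + b ^ 2 = int n}"
  proof (intro set_eqI iffI)
    fix x assume "x \<in> {(a::int, b::int). a ^ 2 + b ^ 2 = int (2 * n)}"
    then obtain a b :: int where x: "x = (a, b)" and ab: "a ^ 2 + b ^ 2 = int (2 * n)"
      by auto
    have "even (a ^ 2 + b ^ 2)"
      using ab by simp
    hence "even (a + b)" "even (a - b)"
      by simp_all
    then obtain c d where "a + b = 2 * c" "a - b = 2 * d"
      by (meson dvdE)
    hence cd: "a = c + d" "b = c - d"
      by auto
    have "2 * (c ^ 2 + d ^ 2) = 2 * int n"
      using ab by (simp add: cd power2_sum power2_diff)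
    hence "c ^ 2 + d ^ 2 = int n"
      by simp
    thus "x \<in> ?rot ` {(a, b). a ^ 2 + b ^ 2 = int n}"
      by (auto simp: x cd)
  qed (auto simp: power2_sum power2_diff)
  moreover have "inj_on ?rot {(a, b). a ^ 2 + b ^ 2 = int n}"
    by (auto simp: inj_on_def)
  ultimately show "bisect (theta ^ 2) $ n = (theta ^ 2 :: 'a fps) $ n"
    unfolding bisect_nth theta_square_nth by (simp add: card_image)
qed

lemma bisect_theta: "bisect theta = dilate (theta :: 'a::idom fps)"
proof (rule fps_ext)
  fix n
  have "{k::int. k ^ 2 = int (2 * n)} = (\<lambda>k. 2 * k) ` {k. 2 * k ^ 2 = int n}"
  proof (intro set_eqI iffI)
    fix k assume *: "k \<in> {k::int. k ^ 2 = int (2 * n)}"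
    hence "even (k ^ 2)"
      by simp
    then obtain l where "k = 2 * l"
      by (auto elim!: evenE)
    with * show "k \<in> (\<lambda>k. 2 * k) ` {k. 2 * k ^ 2 = int n}"
      by (auto simp: power_mult_distrib)
  qed (auto simp: power_mult_distrib)
  moreover have "{k::int. 2 * k ^ 2 = int n} = (if even n then {k. k ^ 2 = int (n div 2)} else {})"
    by (auto elim!: evenE oddE) presburger
  ultimately show "bisect theta $ n = dilate (theta :: 'a fps) $ n"
    by (simp add: theta_def dilate_nth card_image inj_on_def)
qed

lemma theta_add_reflect:
  "theta + reflect theta = (2 * dilate (dilate theta) :: 'a::{idom, ring_char_0} fps)"
  by (simp add: even_part' bisect_theta)

lemma theta_square_add_reflect:
  "theta ^ 2 + reflect theta ^ 2 = (2 * dilate theta ^ 2 :: 'a::{idom, ring_char_0} fps)"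
  using even_part'[of "theta ^ 2 :: 'a fps"] by (simp add: bisect_theta_square)

text \<open>The classical \<phi>(q) \<phi>(-q) = \<phi>(-q^2)^2. Polarisation expresses the product
  through the sum and the sum of squares of the two factors, both known from the bisections.\<close>

lemma theta_mult_reflect:
  "theta * reflect theta = (dilate (reflect theta) ^ 2 :: 'a::{idom, ring_char_0} fps)"
proof -
  let ?P = "theta :: 'a fps"
  have "2 * (?P * reflect ?P) = (?P + reflect ?P) ^ 2 - (?P ^ 2 + reflect ?P ^ 2)"
    by (simp add: power2_eq_square algebra_simps)
  also have "\<dots> = 2 * dilate (2 * dilate ?P ^ 2 - ?P ^ 2)"
    unfolding theta_add_reflect theta_square_add_reflect by (simp add: power_mult_distrib)
  also have "2 * dilate ?P ^ 2 - ?P ^ 2 = reflect ?P ^ 2"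
    by (simp flip: theta_square_add_reflect)
  finally show ?thesis
    by simp
qed

subsection \<open>A bilateral Kummer sum\<close>

text \<open>The summand of \<open>F(c)\<close> at an index \<open>n >= 0\<close>. At
  \<open>c = q\<close> each factor \<open>q + q^(2i)\<close> releases one \<open>q\<close>, which
  turns \<open>q^(n^2-n)\<close> into \<open>q^(n^2)\<close> and gives the summand of the series for
  \<open>v0\<close>.\<close>

definition kummer_term :: "'a::field fps \<Rightarrow> nat \<Rightarrow> 'a fps"
  where "kummer_term c n = fps_X ^ (n * (n - 1)) * (\<Prod>i=1..n. c + fps_X ^ (2 * i))
    * inverse (\<Prod>i<n. 1 - c * fps_X ^ (2 * i))"

text \<open>
  This is \<open>kummer_term (c * fps_X ^ 2) n\<close> without its factor \<open>fps_X ^ (2 * n)\<close>, which the telescoping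
  certificate would have to divide by.
\<close>

definition kummer_aux :: "'a::field fps \<Rightarrow> nat \<Rightarrow> 'a fps"
  where "kummer_aux c n = fps_X ^ (n * (n - 1)) * (\<Prod>i<n. c + fps_X ^ (2 * i))
    * inverse (\<Prod>i=1..n. 1 - c * fps_X ^ (2 * i))"

lemma kummer_term_0 [simp]: "kummer_term c 0 = 1"
  by (simp add: kummer_term_def)

lemma kummer_aux_0 [simp]: "kummer_aux c 0 = 1"
  by (simp add: kummer_aux_def)

lemma one_minus_unit:
  assumes "c $ 0 = 0"
  shows "inverse (1 - c * fps_X ^ m) * (1 - c * fps_X ^ m) = (1 :: 'a::field fps)"
    and "1 - c * fps_X ^ m \<noteq> (0 :: 'a::field fps)"
proof -
  have *: "(1 - c * fps_X ^ m) $ 0 \<noteq> 0"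
    using assms by simp
  thus "inverse (1 - c * fps_X ^ m) * (1 - c * fps_X ^ m) = 1"
    by (rule inverse_mult_eq_1)
  show "1 - c * fps_X ^ m \<noteq> 0"
    using * by (metis fps_zero_nth)
qed

lemma pronic_Suc: "Suc n * (Suc n - 1) = n * (n - 1) + 2 * n"
  by (cases n) auto

text \<open>The ratio of consecutive terms with its denominator cleared. Special values of the terms
  are later obtained from it by induction.\<close>

lemma kummer_term_Suc:
  assumes "c $ 0 = 0"
  shows "(1 - c * fps_X ^ (2 * n)) * kummer_term c (Suc n) =
    fps_X ^ (2 * n) * (c + fps_X ^ (2 * n + 2)) * kummer_term c n"
proof -
  let ?u = "1 - c * fps_X ^ (2 * n)"
  have "?u * kummer_term c (Suc n) = inverse ?u * ?u *
      (fps_X ^ (2 * n) * (c + fps_X ^ (2 * n + 2)) * kummer_term c n)"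
    unfolding kummer_term_def pronic_Suc
    by (simp add: fps_inverse_mult power_add mult_ac)
  thus ?thesis
    by (simp only: one_minus_unit[OF assms] mult_1)
qed

lemma kummer_aux_Suc:
  assumes "c $ 0 = 0"
  shows "(1 - c * fps_X ^ (2 * n + 2)) * kummer_aux c (Suc n) =
    fps_X ^ (2 * n) * (c + fps_X ^ (2 * n)) * kummer_aux c n"
proof -
  let ?u = "1 - c * fps_X ^ (2 * n + 2)"
  have "?u * kummer_aux c (Suc n) = inverse ?u * ?u *
      (fps_X ^ (2 * n) * (c + fps_X ^ (2 * n)) * kummer_aux c n)"
    unfolding kummer_aux_def pronic_Suc
    by (simp add: fps_inverse_mult power_add mult_ac)
  thus ?thesis
    by (simp only: one_minus_unit[OF assms] mult_1)
qed

lemma kummer_term_shift: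
  "kummer_term (c * fps_X ^ 2) n = fps_X ^ (2 * n) * kummer_aux c n"
proof -
  have "(\<Prod>i=1..n. c * fps_X ^ 2 + fps_X ^ (2 * i)) =
      (\<Prod>i<n. fps_X ^ 2 * (c + fps_X ^ (2 * i)))"
    unfolding One_nat_def prod.atLeast1_atMost_eq by (intro prod.cong) (auto simp: algebra_simps power2_eq_square)
  also have "\<dots> = fps_X ^ (2 * n) * (\<Prod>i<n. c + fps_X ^ (2 * i))"
    by (simp add: prod.distrib power_mult)
  finally have "(\<Prod>i=1..n. c * fps_X ^ 2 + fps_X ^ (2 * i)) =
      fps_X ^ (2 * n) * (\<Prod>i<n. c + fps_X ^ (2 * i))" .
  moreover have "(\<Prod>i<n. 1 - c * fps_X ^ 2 * fps_X ^ (2 * i)) = (\<Prod>i=1..n. 1 - c * fps_X ^ (2 * i))"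
    unfolding One_nat_def prod.atLeast1_atMost_eq by (intro prod.cong) (auto simp: algebra_simps power2_eq_square)
  ultimately show ?thesis
    unfolding kummer_term_def kummer_aux_def by (simp add: mult_ac)
qed

text \<open>The products in the two terms differ only at their ends: \<open>c + 1\<close> against
  \<open>c + q^(2n)\<close> in the numerators, \<open>1 - c\<close> against
  \<open>1 - c q^(2n)\<close> in the denominators.\<close>

lemma kummer_term_eq_aux:
  assumes "c $ 0 = 0"
  shows "(1 - c ^ 2) * kummer_term c n = (c + fps_X ^ (2 * n)) * (1 - c * fps_X ^ (2 * n)) * kummer_aux c n"
proof (induction n)
  case 0
  show ?case
    by (simp add: power2_eq_square algebra_simps)
next
  case (Suc n)
  let ?Y = "fps_X ^ (2 * n) :: 'a fps" and ?Z = "fps_X ^ (2 * n + 2) :: 'a fps"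
  have "(1 - c * ?Y) * ((1 - c ^ 2) * kummer_term c (Suc n)) =
      (1 - c ^ 2) * ((1 - c * ?Y) * kummer_term c (Suc n))"
    by (simp only: mult_ac)
  also have "\<dots> = ?Y * (c + ?Z) * ((1 - c ^ 2) * kummer_term c n)"
    unfolding kummer_term_Suc[OF assms] by (simp only: mult_ac)
  also have "\<dots> = (c + ?Z) * (1 - c * ?Y) * (?Y * (c + ?Y) * kummer_aux c n)"
    unfolding Suc.IH by (simp only: mult_ac)
  also have "\<dots> = (1 - c * ?Y) * ((c + ?Z) * (1 - c * ?Z) * kummer_aux c (Suc n))"
    unfolding kummer_aux_Suc[OF assms, symmetric] by (simp only: mult_ac)
  finally show ?case
    using one_minus_unit(2)[OF assms, of "2 * n"] by simp
qed

text \<open>With \<open>Y = q^(2n)\<close>, the identity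
  \<open>(c + Y)(1 - c Y) - (1 + c^2) Y = c (1 - c Y) - c Y (c + Y)\<close> writes the n-th
  difference as \<open>G n - G (n + 1)\<close>, where
  \<open>G n = c (1 - c Y) * kummer_aux c n\<close>.\<close>

lemma kummer_telescope:
  assumes "c $ 0 = 0"
  shows "(1 - c ^ 2) * (\<Sum>n<N. kummer_term c n) - (1 + c ^ 2) * (\<Sum>n<N. kummer_term (c * fps_X ^ 2) n)
    = c * (1 - c) - c * (1 - c * fps_X ^ (2 * N)) * kummer_aux c N"
proof (induction N)
  case (Suc N)
  let ?Y = "fps_X ^ (2 * N) :: 'a fps" and ?Z = "fps_X ^ (2 * N + 2) :: 'a fps"
  let ?g = "kummer_aux c N"
  have "(1 - c ^ 2) * (\<Sum>n<Suc N. kummer_term c n) - (1 + c ^ 2) * (\<Sum>n<Suc N. kummer_term (c * fps_X ^ 2) n)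
      = c * (1 - c) - c * (1 - c * ?Y) * ?g
        + ((1 - c ^ 2) * kummer_term c N - (1 + c ^ 2) * kummer_term (c * fps_X ^ 2) N)"
    unfolding Suc.IH[symmetric] by (simp add: algebra_simps)
  also have "\<dots> = c * (1 - c) - c * (1 - c * ?Y) * ?g
        + ((c + ?Y) * (1 - c * ?Y) * ?g - (1 + c ^ 2) * (?Y * ?g))"
    by (simp only: kummer_term_eq_aux[OF assms] kummer_term_shift)
  also have "\<dots> = c * (1 - c) - c * (?Y * (c + ?Y) * ?g)"
    by (simp add: algebra_simps power2_eq_square)
  also have "\<dots> = c * (1 - c) - c * ((1 - c * ?Z) * kummer_aux c (Suc N))"
    by (simp only: kummer_aux_Suc[OF assms])
  finally show ?case
    by (simp add: mult.assoc)
qed simp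

text \<open>
  The bilateral sum over all integer indices, cut off at \<open>N\<close>: the product formula for
  \<open>kummer_term c\<close>, continued to \<open>-n\<close>, gives \<open>kummer_term (- c) n\<close>.
\<close>

definition kummer_sum :: "nat \<Rightarrow> 'a::field fps \<Rightarrow> 'a fps"
  where "kummer_sum N c = (\<Sum>n<N. kummer_term c n) + (\<Sum>n<N. kummer_term (- c) n) - 1"

text \<open>The power of \<open>q\<close> in \<open>kummer_aux d N\<close> has exponent
  \<open>N (N - 1)\<close>, which is below \<open>N\<close> only for \<open>N = 1\<close>; the
  factor \<open>c\<close> covers that case.\<close>

lemma X_power_dvd_kummer_aux:
  assumes "fps_X dvd c"
  shows "fps_X ^ N dvd c * kummer_aux d N"
proof -
  have "N \<le> N * (N - 1) + 1"
    by (cases N) auto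
  hence "fps_X ^ N dvd (fps_X ^ (N * (N - 1) + 1) :: 'a fps)"
    by (rule le_imp_power_dvd)
  also have "fps_X ^ (N * (N - 1) + 1) dvd c * fps_X ^ (N * (N - 1))"
    using assms by (simp add: mult_dvd_mono)
  also have "\<dots> dvd c * kummer_aux d N"
    by (simp add: kummer_aux_def mult.assoc mult_dvd_mono)
  finally show ?thesis .
qed

text \<open>The lower boundary values \<open>c (1 - c)\<close> and \<open>- c (1 + c)\<close> of the
  two halves add up to \<open>- 2 c^2\<close>, which the \<open>- 1\<close> in
  \<open>kummer_sum\<close> compensates. Only the upper boundary terms remain, and they have order
  at least \<open>N\<close>.\<close>

lemma kummer_sum_shift:
  fixes c :: "'a::field fps"
  assumes "fps_X dvd c"
  shows "fps_X ^ N dvd (1 - c ^ 2) * kummer_sum N c - (1 + c ^ 2) * kummer_sum N (c * fps_X ^ 2)"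
proof -
  have c0: "c $ 0 = 0" "(- c) $ 0 = 0"
    using assms by (auto elim!: dvdE)
  let ?Y = "fps_X ^ (2 * N) :: 'a fps"
  let ?R = "(1 + c * ?Y) * (c * kummer_aux (- c) N) - (1 - c * ?Y) * (c * kummer_aux c N)"
  have "(1 - c ^ 2) * kummer_sum N c - (1 + c ^ 2) * kummer_sum N (c * fps_X ^ 2) =
     ((1 - c ^ 2) * (\<Sum>n<N. kummer_term c n) - (1 + c ^ 2) * (\<Sum>n<N. kummer_term (c * fps_X ^ 2) n))
   + ((1 - (- c) ^ 2) * (\<Sum>n<N. kummer_term (- c) n) - (1 + (- c) ^ 2) * (\<Sum>n<N. kummer_term (- c * fps_X ^ 2) n))
   + 2 * c ^ 2"
    by (simp add: kummer_sum_def algebra_simps)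
  also have "\<dots> = ?R"
    unfolding kummer_telescope[OF c0(1)] kummer_telescope[OF c0(2)]
    by (simp add: algebra_simps power2_eq_square)
  also have "fps_X ^ N dvd ?R"
    by (rule dvd_diff; rule dvd_mult; rule X_power_dvd_kummer_aux[OF assms])
  finally show ?thesis .
qed

lemma dvd_diff_mult:
  fixes a b c d m :: "'a::comm_ring_1"
  assumes "m dvd a - b" "m dvd c - d"
  shows "m dvd a * c - b * d"
proof -
  have "a * c - b * d = (a - b) * c + b * (c - d)"
    by (simp add: algebra_simps)
  thus ?thesis
    using assms by simp
qed

text \<open>Replacing \<open>c\<close> by \<open>j * c\<close> changes the sign of
  \<open>c^2\<close> and so swaps the factors \<open>1 - c^2\<close> and \<open>1 + c^2\<close>. In
  the product both sides carry the same unit \<open>1 - c^4\<close>.\<close>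

lemma kummer_product_shift:
  fixes c j :: "'a::field fps"
  assumes "fps_X dvd c" and "j ^ 2 = - 1"
  shows "fps_X ^ N dvd kummer_sum N c * kummer_sum N (j * c)
    - kummer_sum N (c * fps_X ^ 2) * kummer_sum N (j * c * fps_X ^ 2)"
proof -
  have jc: "(j * c) ^ 2 = - (c ^ 2)"
    using assms(2) by (simp add: power_mult_distrib)
  have "fps_X ^ N dvd (1 - c ^ 2) * kummer_sum N c * ((1 + c ^ 2) * kummer_sum N (j * c))
     - (1 + c ^ 2) * kummer_sum N (c * fps_X ^ 2) * ((1 - c ^ 2) * kummer_sum N (j * c * fps_X ^ 2))"
    using kummer_sum_shift[OF assms(1), of N] kummer_sum_shift[of "j * c" N, unfolded jc] assms(1)
    by (intro dvd_diff_mult[of _ "_ * _" "_ * _" "_ * _" "_ * _"]) simp_all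
  also have "\<dots> = (1 - c ^ 4) * (kummer_sum N c * kummer_sum N (j * c)
    - kummer_sum N (c * fps_X ^ 2) * kummer_sum N (j * c * fps_X ^ 2))"
    by (simp add: algebra_simps flip: power_add)
  finally show ?thesis
  proof (subst (asm) dvd_mult_unit_iff')
    show "is_unit (1 - c ^ 4)"
      using assms(1) by (auto elim!: dvdE simp: fps_nth_power_0)
  qed
qed

lemma diff_add_diff_cancel: "(a - b) + (b - c) = a - (c :: 'a::ab_group_add)"
  by simp

lemma kummer_product_shifts:
  fixes j :: "'a::field fps"
  assumes "j ^ 2 = - 1"
  shows "fps_X ^ N dvd kummer_sum N fps_X * kummer_sum N (j * fps_X)
    - kummer_sum N (fps_X ^ (2 * k + 1)) * kummer_sum N (j * fps_X ^ (2 * k + 1))"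
proof (induction k)
  case (Suc k)
  have e: "fps_X ^ (2 * Suc k + 1) = fps_X ^ (2 * k + 1) * (fps_X :: 'a fps) ^ 2"
    by (simp flip: power_add)
  have "fps_X ^ N dvd kummer_sum N (fps_X ^ (2 * k + 1)) * kummer_sum N (j * fps_X ^ (2 * k + 1))
    - kummer_sum N (fps_X ^ (2 * Suc k + 1)) * kummer_sum N (j * fps_X ^ (2 * Suc k + 1))"
    using kummer_product_shift[OF _ assms, of "fps_X ^ (2 * k + 1)" N]
    unfolding e mult.assoc by simp
  from dvd_add[OF Suc.IH this] show ?case
    by (simp only: diff_add_diff_cancel)
qed simp

text \<open>At \<open>c = 0\<close> the term is \<open>q^(n(n-1)) q^(n(n+1))\<close>.\<close>

lemma kummer_term_near_0:
  fixes c :: "'a::field fps"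
  assumes "fps_X ^ M dvd c" and "c $ 0 = 0"
  shows "fps_X ^ M dvd kummer_term c n - fps_X ^ (2 * n ^ 2)"
proof (induction n)
  case (Suc n)
  \<comment> \<open>Moving the \<open>c\<close>-part of the denominator to the right leaves, modulo
    \<open>c\<close>, the recurrence of \<open>q^(2n^2)\<close>.\<close>
  have "kummer_term c (Suc n) = c * fps_X ^ (2 * n) * kummer_term c (Suc n)
      + (1 - c * fps_X ^ (2 * n)) * kummer_term c (Suc n)"
    by (simp add: algebra_simps)
  also note kummer_term_Suc[OF assms(2)]
  finally have "kummer_term c (Suc n) = c * fps_X ^ (2 * n) * kummer_term c (Suc n)
      + fps_X ^ (2 * n) * (c + fps_X ^ (2 * n + 2)) * kummer_term c n" .
  moreover have "fps_X ^ (2 * Suc n ^ 2) = fps_X ^ (2 * n) * fps_X ^ (2 * n + 2) * (fps_X :: 'a fps) ^ (2 * n ^ 2)"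
    by (simp add: power2_eq_square algebra_simps flip: power_add)
  ultimately have "kummer_term c (Suc n) - fps_X ^ (2 * Suc n ^ 2) =
      c * (fps_X ^ (2 * n) * kummer_term c (Suc n) + fps_X ^ (2 * n) * kummer_term c n)
      + fps_X ^ (2 * n) * fps_X ^ (2 * n + 2) * (kummer_term c n - fps_X ^ (2 * n ^ 2))"
    by (simp add: algebra_simps)
  thus ?case
    using assms(1) Suc.IH by (simp del: power_Suc)
qed simp

lemma kummer_sum_near_0:
  fixes c :: "'a::field fps"
  assumes "fps_X ^ M dvd c" and "c $ 0 = 0"
  shows "fps_X ^ M dvd kummer_sum N c - (2 * (\<Sum>n<N. fps_X ^ (2 * n ^ 2)) - 1)"
proof -
  have "kummer_sum N c - (2 * (\<Sum>n<N. fps_X ^ (2 * n ^ 2)) - 1) =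
    (\<Sum>n<N. kummer_term c n - fps_X ^ (2 * n ^ 2)) + (\<Sum>n<N. kummer_term (- c) n - fps_X ^ (2 * n ^ 2))"
    by (simp add: kummer_sum_def sum_subtractf)
  thus ?thesis
    using assms kummer_term_near_0[of M c] kummer_term_near_0[of M "- c"]
    by (auto intro!: dvd_add dvd_sum)
qed

text \<open>Since \<open>1 / j = - j\<close>, the factor \<open>j q + q^(2i)\<close> equals
  \<open>j q (1 - j q^(2i-1))\<close>, so the numerator cancels the denominator up to
  \<open>j^n q^n\<close>.\<close>

lemma kummer_term_imaginary:
  fixes j :: "'a::field fps"
  assumes "j ^ 2 = - 1"
  shows "kummer_term (j * fps_X) n = j ^ n * fps_X ^ (n ^ 2)"
proof (induction n)
  case (Suc n)
  let ?u = "1 - j * fps_X * fps_X ^ (2 * n)"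
  have c0: "(j * fps_X) $ 0 = 0"
    by simp
  have j: "j * (j * a) = - a" for a
    using assms by (simp add: power2_eq_square flip: mult.assoc)
  have "?u * kummer_term (j * fps_X) (Suc n) = ?u * (j * fps_X ^ (2 * n + 1) * (j ^ n * fps_X ^ (n ^ 2)))"
    unfolding kummer_term_Suc[OF c0] Suc.IH
    by (simp add: algebra_simps j power2_eq_square power_add)
  also have "Suc n ^ 2 = (2 * n + 1) + n ^ 2"
    by (simp add: power2_eq_square)
  hence "j * fps_X ^ (2 * n + 1) * (j ^ n * fps_X ^ (n ^ 2)) = j ^ Suc n * fps_X ^ (Suc n ^ 2)"
    by (simp only: power_add power_Suc mult_ac)
  finally show ?case
    using one_minus_unit(2)[OF c0, of "2 * n"] by (simp del: power_Suc)
qed simp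

lemma reflect_kummer_term: "reflect (kummer_term fps_X n) = kummer_term (- fps_X) n"
proof (induction n)
  case (Suc n)
  have c0: "fps_X $ 0 = (0::'a)" "(- fps_X :: 'a fps) $ 0 = 0"
    by simp_all
  have "reflect ((1 - fps_X * fps_X ^ (2 * n)) * kummer_term fps_X (Suc n)) =
    reflect (fps_X ^ (2 * n) * (fps_X + fps_X ^ (2 * n + 2)) * kummer_term (fps_X :: 'a fps) n)"
    by (simp only: kummer_term_Suc[OF c0(1)])
  hence "(1 - - fps_X * fps_X ^ (2 * n)) * reflect (kummer_term fps_X (Suc n)) =
    fps_X ^ (2 * n) * (- fps_X + fps_X ^ (2 * n + 2)) * kummer_term (- fps_X :: 'a fps) n"
    by (simp add: Suc.IH reflect_X power_mult)
  also have "\<dots> = (1 - - fps_X * fps_X ^ (2 * n)) * kummer_term (- fps_X) (Suc n)"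
    by (simp only: kummer_term_Suc[OF c0(2)])
  finally show ?case
    using one_minus_unit(2)[OF c0(2), of "2 * n"] by simp
qed simp

subsection \<open>The generating function of v0(4n)\<close>

text \<open>Divisibility by \<open>fps_X ^ N\<close> serves as agreement of the first
  \<open>N\<close> coefficients, so infinite series can be compared through their
  truncations.\<close>

lemma X_power_dvd_iff: "fps_X ^ N dvd f \<longleftrightarrow> (\<forall>k<N. f $ k = (0 :: 'a::comm_ring_1))"
proof
  assume "\<forall>k<N. f $ k = 0"
  hence "f = fps_X ^ N * fps_shift N f"
    by (intro fps_ext) (auto simp: fps_X_power_mult_nth)
  thus "fps_X ^ N dvd f"
    by (metis dvd_triv_left)
qed (auto elim!: dvdE simp: fps_X_power_mult_nth)

lemma nth_sum_squares:
  assumes "k < N"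
  shows "(\<Sum>n<N. fps_const (a n) * fps_X ^ (n ^ 2)) $ k =
    (\<Sum>n | n ^ 2 = k. a n :: 'a::comm_ring_1)"
proof -
  have "(\<Sum>n<N. fps_const (a n) * fps_X ^ (n ^ 2)) $ k = (\<Sum>n<N. if n ^ 2 = k then a n else 0)"
    by (simp add: fps_sum_nth fps_X_power_nth cong: if_cong) (intro sum.cong, auto)
  also have "\<dots> = (\<Sum>n | n < N \<and> n ^ 2 = k. a n)"
    by (simp add: sum.If_cases Int_def)
  also have "{n. n < N \<and> n ^ 2 = k} = {n. n ^ 2 = k}"
    using assms by (auto simp: power2_eq_square intro: le_less_trans[OF le_square])
  finally show ?thesis .
qed

lemma square_roots_nat: "{n::nat. n ^ 2 = m ^ 2} = {m}"
  by auto

lemma theta_partial: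
  "fps_X ^ N dvd theta - (2 * (\<Sum>n<N. fps_X ^ (n ^ 2)) - 1 :: 'a::idom fps)"
  unfolding X_power_dvd_iff
proof (intro allI impI)
  fix k assume k: "k < N"
  note s = nth_sum_squares[OF k, of "\<lambda>_. 1::'a"]
  show "(theta - (2 * (\<Sum>n<N. fps_X ^ (n ^ 2)) - 1 :: 'a fps)) $ k = 0"
  proof (cases "\<exists>m. k = m ^ 2")
    case True
    then obtain m where m: "k = m ^ 2" ..
    show ?thesis
      using s theta_nth_square[of m, where 'a = 'a]
      by (simp add: m square_roots_nat numeral_fps_const)
  next
    case False
    have "k \<noteq> 0"
      using False by (metis power_zero_numeral)
    from False have "{n. n ^ 2 = k} = {}"
      by auto
    with s \<open>k \<noteq> 0\<close> show ?thesis
      using False theta_nth_nonsquare[OF False, where 'a = 'a]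
      by (auto simp: numeral_fps_const)
  qed
qed

lemma theta_dilate_partial:
  "fps_X ^ N dvd dilate theta - (2 * (\<Sum>n<N. fps_X ^ (2 * n ^ 2)) - 1 :: 'a::idom fps)"
proof -
  obtain r :: "'a fps" where "theta - (2 * (\<Sum>n<N. fps_X ^ (n ^ 2)) - 1) = fps_X ^ N * r"
    using theta_partial by (auto elim!: dvdE)
  hence "dilate (theta - (2 * (\<Sum>n<N. fps_X ^ (n ^ 2)) - 1)) = dilate (fps_X ^ N * r)"
    by simp
  hence "dilate theta - (2 * (\<Sum>n<N. fps_X ^ (2 * n ^ 2)) - 1) = (fps_X ^ 2) ^ N * dilate r"
    by (simp add: dilate_sum dilate_X flip: power_mult)
  also have "fps_X ^ N dvd (fps_X ^ 2) ^ N * dilate r"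
    by (simp add: power_mult_distrib power2_eq_square mult.assoc)
  finally show ?thesis .
qed

text \<open>The sum \<open>\<i>^m + (-\<i>)^m\<close> vanishes for odd \<open>m\<close> and is
  \<open>2 (-1)^l\<close> for \<open>m = 2l\<close>, so only the terms
  \<open>(-1)^l q^(4l^2)\<close> of \<phi>(-q^4) survive.\<close>

lemma theta_imaginary_partial:
  "fps_X ^ N dvd dilate (dilate (reflect theta)) -
    ((\<Sum>n<N. fps_const (\<i> ^ n) * fps_X ^ (n ^ 2)) + (\<Sum>n<N. fps_const ((- \<i>) ^ n) * fps_X ^ (n ^ 2)) - 1)"
  unfolding X_power_dvd_iff
proof (intro allI impI)
  fix k assume k: "k < N"
  note s = nth_sum_squares[OF k, of "\<lambda>n. \<i> ^ n"] nth_sum_squares[OF k, of "\<lambda>n. (- \<i>) ^ n"]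
  have "dilate (dilate (reflect theta)) $ k =
    (\<Sum>n | n ^ 2 = k. \<i> ^ n) + (\<Sum>n | n ^ 2 = k. (- \<i>) ^ n) - (1 $ k)"
  proof (cases "\<exists>m. k = m ^ 2")
    case True
    then obtain m where m: "k = m ^ 2" ..
    show ?thesis
    proof (cases "even m")
      case True
      then obtain l where l: "m = 2 * l" ..
      have "k = 2 * (2 * l ^ 2)"
        by (simp add: m l power_mult_distrib)
      hence "dilate (dilate (reflect theta)) $ k = (- 1) ^ l * (if l = 0 then 1 else 2 :: complex)"
        by (simp add: dilate_nth reflect_nth theta_nth_square minus_one_power_iff)
      thus ?thesis
        unfolding m square_roots_nat by (simp add: l power_mult)
    next
      case False
      thus ?thesis
        unfolding m square_roots_nat by (simp add: dilate_nth power_minus_odd) (auto elim: oddE)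
    qed
  next
    case False
    have "k \<noteq> 0"
      using False by (metis power_zero_numeral)
    from False have "{n. n ^ 2 = k} = {}"
      by auto
    with \<open>k \<noteq> 0\<close> have "(\<Sum>n | n ^ 2 = k. \<i> ^ n) + (\<Sum>n | n ^ 2 = k. (- \<i>) ^ n) - (1 $ k) = 0"
      by simp
    moreover have "dilate (dilate (reflect theta)) $ k = (0::complex)"
    proof (cases "\<exists>l. k = 2 * (2 * l)")
      case True
      then obtain l where l: "k = 2 * (2 * l)" ..
      have "\<nexists>m. l = m ^ 2"
      proof
        assume "\<exists>m. l = m ^ 2"
        then obtain m where "l = m ^ 2" ..
        hence "k = (2 * m) ^ 2"
          by (simp add: l power_mult_distrib)
        with False show False
          by blast
      qed
      thus ?thesis
        by (simp add: l dilate_nth reflect_nth theta_nth_nonsquare)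
    qed (auto simp: dilate_nth elim!: evenE)
    ultimately show ?thesis
      by simp
  qed
  thus "(dilate (dilate (reflect theta)) -
    ((\<Sum>n<N. fps_const (\<i> ^ n) * fps_X ^ (n ^ 2)) + (\<Sum>n<N. fps_const ((- \<i>) ^ n) * fps_X ^ (n ^ 2)) - 1)) $ k = 0"
    by (simp only: s fps_sub_nth fps_add_nth diff_self)
qed

section \<open>Transfer from integer to complex coefficients\<close>

definition complex_fps :: "int fps \<Rightarrow> complex fps"
  where "complex_fps f = Abs_fps (\<lambda>n. of_int (f $ n))"

lemma complex_fps_nth [simp]: "complex_fps f $ n = of_int (f $ n)"
  by (simp add: complex_fps_def)

lemma complex_fps_inject: "complex_fps f = complex_fps g \<Longrightarrow> f = g"
  by (simp add: fps_eq_iff)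

lemma complex_fps_hom [simp]:
  "complex_fps (f + g) = complex_fps f + complex_fps g"
  "complex_fps (f - g) = complex_fps f - complex_fps g"
  "complex_fps (f * g) = complex_fps f * complex_fps g"
  "complex_fps 1 = 1" "complex_fps fps_X = fps_X"
  "complex_fps (dilate f) = dilate (complex_fps f)"
  "complex_fps (reflect f) = reflect (complex_fps f)"
  "complex_fps theta = theta"
  by (simp_all add: fps_eq_iff fps_mult_nth dilate_nth reflect_nth theta_def)

lemma complex_fps_power [simp]: "complex_fps (f ^ n) = complex_fps f ^ n"
  by (induction n) simp_all

lemma complex_fps_sum: "complex_fps (sum f A) = (\<Sum>n\<in>A. complex_fps (f n))"
  by (simp add: fps_eq_iff fps_sum_nth)

text \<open>The integer counterpart of \<open>kummer_term_Suc\<close> at \<open>c = q\<close>.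
  Matching recurrences identifies the summands over the complex numbers without transferring
  \<open>fps_right_inverse\<close>.\<close>

lemma v0_summand_Suc:
  "(1 - fps_X ^ (2 * n + 1)) * v0_summand (Suc n) = fps_X ^ (2 * n + 1) * (1 + fps_X ^ (2 * n + 1)) * v0_summand n"
proof -
  let ?q = "\<lambda>n. qpochhammer fps_X (fps_X ^ 2) n :: int fps"
  let ?i = "\<lambda>n. fps_right_inverse (?q n) 1"
  let ?Y = "fps_X ^ (2 * n + 1) :: int fps"
  have Y: "fps_X * (fps_X ^ 2) ^ n = ?Y"
    by (simp flip: power_mult)
  have q: "?q (Suc n) = ?q n * (1 - ?Y)"
    by (simp add: qpochhammer_def Y del: power_Suc)
  have "(1 - ?Y) * ?i (Suc n) = (1 - ?Y) * ?i (Suc n) * (?q n * ?i n)"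
    by (simp only: denominator_inverse mult_1_right)
  also have "\<dots> = ?q (Suc n) * ?i (Suc n) * ?i n"
    unfolding q by (simp only: mult_ac)
  finally have i: "(1 - ?Y) * ?i (Suc n) = ?i n"
    by (simp only: denominator_inverse mult_1)
  have p: "qpochhammer (- fps_X) (fps_X ^ 2) (Suc n) = qpochhammer (- fps_X) (fps_X ^ 2) n * (1 + ?Y)"
    by (simp add: qpochhammer_def Y del: power_Suc)
  have "Suc n ^ 2 = n ^ 2 + (2 * n + 1)"
    by (simp add: power2_eq_square)
  hence x: "fps_X ^ (Suc n ^ 2) = fps_X ^ (n ^ 2) * ?Y"
    by (simp only: power_add)
  have "(1 - ?Y) * v0_summand (Suc n) =
      fps_X ^ (n ^ 2) * ?Y * (qpochhammer (- fps_X) (fps_X ^ 2) n * (1 + ?Y)) * ((1 - ?Y) * ?i (Suc n))"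
    unfolding v0_summand_def p x by (simp only: mult_ac)
  also have "\<dots> = ?Y * (1 + ?Y) * v0_summand n"
    unfolding i v0_summand_def by (simp only: mult_ac)
  finally show ?thesis .
qed

lemma complex_v0_summand: "complex_fps (v0_summand n) = kummer_term fps_X n"
proof (induction n)
  case 0
  show ?case
    using denominator_inverse[of 0] by (simp add: v0_summand_def qpochhammer_def)
next
  case (Suc n)
  have c0: "fps_X $ 0 = (0::complex)"
    by simp
  let ?u = "1 - fps_X * fps_X ^ (2 * n) :: complex fps"
  have "complex_fps ((1 - fps_X ^ (2 * n + 1)) * v0_summand (Suc n)) =
    complex_fps (fps_X ^ (2 * n + 1) * (1 + fps_X ^ (2 * n + 1)) * v0_summand n)"
    by (simp only: v0_summand_Suc)
  hence "?u * complex_fps (v0_summand (Suc n)) =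
    fps_X ^ (2 * n) * (fps_X + fps_X ^ (2 * n + 2)) * kummer_term fps_X n"
    by (simp add: Suc.IH algebra_simps)
  also have "\<dots> = ?u * kummer_term fps_X (Suc n)"
    by (simp only: kummer_term_Suc[OF c0])
  finally show ?case
    using one_minus_unit(2)[OF c0, of "2 * n"] by (simp del: power_Suc)
qed

lemma v0_partial: "fps_X ^ N dvd Abs_fps v0 - (\<Sum>n<N. v0_summand n)"
  unfolding X_power_dvd_iff
proof (intro allI impI)
  fix k assume "k < N"
  have "\<forall>\<^sub>F M in sequentially. (\<Sum>n<M. v0_summand n) $ k = Abs_fps v0 $ k"
    using v0_summand_sums unfolding sums_def tendsto_fps_iff by blast
  then obtain M where M: "\<And>m. m \<ge> M \<Longrightarrow> (\<Sum>n<m. v0_summand n) $ k = v0 k"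
    by (auto simp: eventually_sequentially)
  have "(\<Sum>n<N. v0_summand n $ k) = (\<Sum>n<max M N. v0_summand n $ k)"
    using \<open>k < N\<close> by (intro sum.mono_neutral_left) (auto simp: v0_summand_nth_eq_0)
  thus "(Abs_fps v0 - (\<Sum>n<N. v0_summand n)) $ k = 0"
    using M[of "max M N"] by (simp add: fps_sum_nth)
qed

text \<open>The degree \<open>k\<close> coefficient is read off modulo \<open>q^(k+1)\<close>: the
  left side is the product of Kummer sums at \<open>q\<close> and \<open>\<i> q\<close>, and
  shifting both arguments towards 0 turns each factor into \<phi>(q^2).\<close>

lemma v0_even_part:
  "(Abs_fps v0 + reflect (Abs_fps v0) - 1) * dilate (dilate (reflect theta)) = dilate theta ^ 2"
proof (rule complex_fps_inject, rule fps_ext)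
  fix k
  let ?N = "Suc k"
  let ?v = "complex_fps (Abs_fps v0)"
  let ?j = "fps_const \<i>"
  let ?S = "2 * (\<Sum>n<?N. fps_X ^ (2 * n ^ 2)) - 1 :: complex fps"
  have j: "?j ^ 2 = - 1"
    by (simp add: fps_const_power flip: fps_const_neg)
  have v: "fps_X ^ ?N dvd ?v + reflect ?v - 1 - kummer_sum ?N fps_X"
  proof -
    obtain r where "Abs_fps v0 - (\<Sum>n<?N. v0_summand n) = fps_X ^ ?N * r"
      by (rule dvdE[OF v0_partial])
    hence "complex_fps (Abs_fps v0 - (\<Sum>n<?N. v0_summand n)) = complex_fps (fps_X ^ ?N * r)"
      by (rule arg_cong)
    hence r: "?v - (\<Sum>n<?N. kummer_term fps_X n) = fps_X ^ ?N * complex_fps r"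
      by (simp add: complex_fps_sum complex_v0_summand del: power_Suc sum.lessThan_Suc)
    hence "reflect (?v - (\<Sum>n<?N. kummer_term fps_X n)) = reflect (fps_X ^ ?N * complex_fps r)"
      by (rule arg_cong)
    hence "reflect ?v - (\<Sum>n<?N. kummer_term (- fps_X) n) = (- fps_X) ^ ?N * reflect (complex_fps r)"
      by (simp add: reflect_sum reflect_kummer_term reflect_X del: power_Suc sum.lessThan_Suc)
    also have "\<dots> = fps_X ^ ?N * ((- 1) ^ ?N * reflect (complex_fps r))"
      by (subst power_minus) (simp only: mult_ac)
    finally have "?v + reflect ?v - 1 - kummer_sum ?N fps_X =
        fps_X ^ ?N * (complex_fps r + (- 1) ^ ?N * reflect (complex_fps r))"
      using r by (simp add: kummer_sum_def algebra_simps del: power_Suc sum.lessThan_Suc)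
    thus ?thesis
      by simp
  qed
  have d: "fps_X ^ ?N dvd dilate (dilate (reflect theta)) - kummer_sum ?N (?j * fps_X)"
  proof -
    have neg: "- (?j * fps_X) = fps_const (- \<i>) * fps_X"
      by (simp flip: fps_const_neg)
    have "fps_const (- \<i>) ^ 2 = - 1"
      using j by (simp flip: fps_const_neg)
    hence t: "kummer_term (fps_const (- \<i>) * fps_X) n = fps_const ((- \<i>) ^ n) * fps_X ^ (n ^ 2)" for n
      using kummer_term_imaginary by (metis fps_const_power)
    have t': "kummer_term (?j * fps_X) n = fps_const (\<i> ^ n) * fps_X ^ (n ^ 2)" for n
      using kummer_term_imaginary[OF j] by (metis fps_const_power)
    show ?thesis
      using theta_imaginary_partial[of ?N] unfolding kummer_sum_def neg t t' .
  qed
  \<comment> \<open>After \<open>?N\<close> shifts the argument is divisible by \<open>q^?N\<close>,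
    hence indistinguishable from 0 at this precision.\<close>
  have near: "fps_X ^ ?N dvd kummer_sum ?N (c * fps_X ^ (2 * ?N + 1)) - dilate theta" for c :: "complex fps"
  proof -
    have "fps_X ^ ?N dvd c * fps_X ^ (2 * ?N + 1)"
      by (intro dvd_mult le_imp_power_dvd) simp
    hence "fps_X ^ ?N dvd kummer_sum ?N (c * fps_X ^ (2 * ?N + 1)) - ?S"
      by (intro kummer_sum_near_0) auto
    from dvd_diff[OF this theta_dilate_partial[of ?N]] show ?thesis
      by (simp del: power_Suc sum.lessThan_Suc)
  qed
  have "fps_X ^ ?N dvd (?v + reflect ?v - 1) * dilate (dilate (reflect theta)) -
      kummer_sum ?N fps_X * kummer_sum ?N (?j * fps_X)"
    by (rule dvd_diff_mult[OF v d])
  from dvd_add[OF dvd_add[OF this kummer_product_shifts[OF j, of ?N ?N]]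
      dvd_diff_mult[OF near[of 1] near[of ?j]]]
  have "fps_X ^ ?N dvd (?v + reflect ?v - 1) * dilate (dilate (reflect theta)) - dilate theta * dilate theta"
    by (simp only: diff_add_diff_cancel mult_1)
  hence "((?v + reflect ?v - 1) * dilate (dilate (reflect theta)) - dilate theta * dilate theta) $ k = 0"
    unfolding X_power_dvd_iff by blast
  thus "complex_fps ((Abs_fps v0 + reflect (Abs_fps v0) - 1) * dilate (dilate (reflect theta))) $ k =
      complex_fps (dilate theta ^ 2) $ k"
    by (simp add: power2_eq_square del: complex_fps_nth)
qed

text \<open>The even part of the generating function gives \<open>(2 * bisect v - 1)\<close>
  \<phi>(-q^2) = \<phi>(q)^2. Bisecting again leaves the right side fixed and undoes the dilation of
  \<phi>(-q^2).\<close>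

lemma bisect_bisect_v0: "(2 * bisect (bisect (Abs_fps v0)) - 1) * reflect theta = theta ^ 2"
proof -
  have "dilate ((2 * bisect (Abs_fps v0) - 1) * dilate (reflect theta)) = dilate (theta ^ 2)"
    using v0_even_part by (simp add: even_part')
  hence "bisect (dilate (reflect theta) * (2 * bisect (Abs_fps v0) - 1)) = bisect (theta ^ 2)"
    by (metis dilate_inject mult.commute)
  moreover have "bisect 1 = (1 :: int fps)"
    by (metis bisect_dilate dilate_ring_hom(5))
  ultimately show ?thesis
    unfolding bisect_dilate_mult bisect_theta_square by (simp add: mult.commute)
qed

subsection \<open>Two-adic contraction\<close>

text \<open>The subring generated by \<open>x\<close>, given by few closure rules to keep inductions
  over it short.\<close>

inductive_set ring_gen :: "'a::comm_ring_1 \<Rightarrow> 'a set" for x :: 'a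
  where
    one: "1 \<in> ring_gen x"
  | diff: "a \<in> ring_gen x \<Longrightarrow> b \<in> ring_gen x \<Longrightarrow> a - b \<in> ring_gen x"
  | mult_gen: "a \<in> ring_gen x \<Longrightarrow> x * a \<in> ring_gen x"

lemma ring_gen_uminus: "a \<in> ring_gen x \<Longrightarrow> - a \<in> ring_gen x"
  by (metis diff diff_0 diff_self)

lemma ring_gen_add: "a \<in> ring_gen x \<Longrightarrow> b \<in> ring_gen x \<Longrightarrow> a + b \<in> ring_gen x"
  by (metis diff diff_minus_eq_add ring_gen_uminus)

lemma ring_gen_mult: "a \<in> ring_gen x \<Longrightarrow> b \<in> ring_gen x \<Longrightarrow> a * b \<in> ring_gen x"
  by (induction rule: ring_gen.induct) (auto intro: ring_gen.intros simp: left_diff_distrib mult.assoc)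

lemma ring_gen_numeral: "numeral k \<in> ring_gen x"
  by (induction k) (auto intro: ring_gen.one ring_gen_add simp only: numeral.simps)

lemma ring_gen_self: "x \<in> ring_gen x"
  using mult_gen[OF one, of x] by simp

lemma ring_gen_0: "0 \<in> ring_gen x"
  using diff[OF one one, of x] by simp

lemma ring_gen_power: "a \<in> ring_gen x \<Longrightarrow> a ^ n \<in> ring_gen x"
  by (induction n) (auto intro: ring_gen.one ring_gen_mult)

lemmas ring_gen_closed = ring_gen.intros ring_gen_0 ring_gen_self ring_gen_uminus ring_gen_add
  ring_gen_mult ring_gen_numeral ring_gen_power

text \<open>For a polynomial in a series without constant term, the coefficient at 0 is the constant
  term of the polynomial. When it vanishes, a factor \<open>x\<close> splits off inside the
  ring.\<close>

lemma ring_gen_split_const: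
  fixes x :: "int fps"
  assumes "f \<in> ring_gen x" and "x $ 0 = 0"
  obtains g where "g \<in> ring_gen x" "f = fps_const (f $ 0) + x * g"
proof -
  from assms(1) have "\<exists>g\<in>ring_gen x. f = fps_const (f $ 0) + x * g"
  proof induction
    case one
    show ?case
      by (rule bexI[of _ 0]) (auto intro: ring_gen_0)
  next
    case (diff a b)
    then obtain g h where "g \<in> ring_gen x" "a = fps_const (a $ 0) + x * g"
      "h \<in> ring_gen x" "b = fps_const (b $ 0) + x * h"
      by blast
    moreover from this have "a - b = fps_const ((a - b) $ 0) + x * (g - h)"
      by (simp add: algebra_simps flip: fps_const_sub)
    ultimately show ?case
      by (blast intro: ring_gen.diff)
  next
    case (mult_gen a)
    thus ?case
      using assms(2) by (intro bexI[of _ a]) auto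
  qed
  thus thesis
    using that by blast
qed

section \<open>The series \<nu>, \<sigma>, \<omega> and their relations\<close>

definition theta_recip :: "int fps"
  where "theta_recip = fps_right_inverse (reflect theta) 1"

definition nu :: "int fps"
  where "nu = (theta - reflect theta) * theta_recip"

definition sigma :: "int fps"
  where "sigma = 2 * (theta ^ 2 - dilate theta ^ 2) * theta_recip ^ 2"

definition omega :: "int fps"
  where "omega = 4 * (theta * theta_recip) ^ 4 - 4"

lemma theta_recip: "reflect theta * theta_recip = 1"
  unfolding theta_recip_def by (rule fps_right_inverse) (simp add: reflect_nth)

lemma dilate_theta_recip: "dilate theta_recip ^ 2 * (theta * reflect theta) = 1"
proof -
  have "dilate theta_recip ^ 2 * (theta * reflect theta) = dilate (reflect theta * theta_recip) ^ 2"
    unfolding theta_mult_reflect by (simp add: power_mult_distrib mult.commute)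
  thus ?thesis
    by (simp add: theta_recip)
qed

text \<open>Rationalises the denominator: 1/\<phi>(-q) = \<phi>(q)/\<phi>(-q^2)^2, where the new
  denominator is invariant under reflection.\<close>

lemma theta_recip_eq: "theta_recip = dilate theta_recip ^ 2 * theta"
proof -
  have "dilate theta_recip ^ 2 * theta * (reflect theta * theta_recip) =
      dilate theta_recip ^ 2 * (theta * reflect theta) * theta_recip"
    by (simp only: mult_ac)
  thus ?thesis
    by (simp add: theta_recip dilate_theta_recip)
qed

lemma one_plus_nu: "1 + nu = theta * theta_recip"
  using theta_recip by (simp add: nu_def algebra_simps)

lemma theta_diff_square:
  "(theta - reflect theta) ^ 2 = (4 * dilate (theta ^ 2 - dilate theta ^ 2) :: int fps)"
proof -
  have "(theta - reflect theta) ^ 2 = 2 * (theta ^ 2 + reflect theta ^ 2) - (theta + reflect theta) ^ (2::nat)"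
    for theta :: "int fps"
    by (simp add: power2_eq_square algebra_simps)
  hence "(theta - reflect theta :: int fps) ^ 2 = 2 * (2 * dilate theta ^ 2) - (2 * dilate (dilate theta)) ^ 2"
    by (simp only: theta_square_add_reflect theta_add_reflect)
  thus ?thesis
    by (simp add: power_mult_distrib)
qed

lemma theta_square_diff:
  "2 * (theta ^ 2 - dilate theta ^ 2) = (theta ^ 2 - reflect theta ^ 2 :: int fps)"
  using theta_square_add_reflect[where 'a = int] by (simp add: algebra_simps)

lemma theta_square_diff_square:
  "(theta ^ 2 - reflect theta ^ 2) ^ 2 = 4 * (dilate theta ^ 4 - (theta * reflect theta :: int fps) ^ 2)"
proof -
  have "(theta ^ 2 - reflect theta ^ 2) ^ 2 = (theta ^ 2 + reflect theta ^ 2) ^ 2 - 4 * (theta * reflect theta :: int fps) ^ 2"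
    by (simp add: power2_eq_square algebra_simps)
  also have "\<dots> = (2 * dilate theta ^ 2) ^ 2 - 4 * (theta * reflect theta :: int fps) ^ 2"
    by (simp only: theta_square_add_reflect)
  finally show ?thesis
    by (simp add: power_mult_distrib flip: power_mult)
qed

text \<open>Only one of the two factors \<open>theta_recip\<close> is rationalised. It completes the
  squared difference to \<open>2 * dilate sigma\<close>, and the other one forms
  \<phi>(q)/\<phi>(-q) with the \<phi>(q) left over.\<close>

lemma nu_square: "nu ^ 2 = 2 * dilate sigma * (1 + nu)"
proof -
  have "nu ^ 2 = 4 * dilate (theta ^ 2 - dilate theta ^ 2) * (dilate theta_recip ^ 2 * theta) * theta_recip"
    unfolding nu_def power_mult_distrib theta_diff_square
    by (simp only: power2_eq_square[of theta_recip] theta_recip_eq[symmetric] mult.assoc)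
  also have "\<dots> = 2 * dilate sigma * (theta * theta_recip)"
    by (simp add: sigma_def mult_ac)
  finally show ?thesis
    by (simp only: one_plus_nu)
qed

lemma sigma_eq: "sigma = (theta ^ 2 - reflect theta ^ 2) * theta_recip ^ 2"
  by (simp only: sigma_def theta_square_diff)

lemma one_plus_sigma: "1 + sigma = (theta * theta_recip) ^ 2"
proof -
  have "(theta * theta_recip) ^ 2 = (theta ^ 2 - reflect theta ^ 2) * theta_recip ^ 2 + (reflect theta * theta_recip) ^ 2"
    by (simp add: power_mult_distrib algebra_simps)
  thus ?thesis
    unfolding sigma_eq theta_recip by (simp only: power_one add.commute)
qed

lemma dilate_omega:
  "dilate omega = 4 * (dilate theta ^ 4 - (theta * reflect theta) ^ 2) * dilate theta_recip ^ 4"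
proof -
  have "(dilate theta_recip ^ 2 * (theta * reflect theta)) ^ 2 = 1"
    by (simp only: dilate_theta_recip power_one)
  hence "(theta * reflect theta) ^ 2 * dilate theta_recip ^ 4 = 1"
    by (simp add: power_mult_distrib mult_ac flip: power_mult)
  thus ?thesis
    by (simp add: omega_def algebra_simps power_mult_distrib)
qed

lemma sigma_eq': "sigma = (theta ^ 2 - reflect theta ^ 2) * (theta ^ 2 * dilate theta_recip ^ 4)"
proof -
  have "theta_recip ^ 2 = (dilate theta_recip ^ 2 * theta) ^ 2"
    using theta_recip_eq by (rule arg_cong)
  also have "\<dots> = theta ^ 2 * dilate theta_recip ^ 4"
    by (simp add: power_mult_distrib flip: power_mult)
  finally show ?thesis
    by (simp only: sigma_eq)
qed

lemma sigma_square: "sigma ^ 2 = dilate omega * (1 + sigma)"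
proof -
  have "sigma ^ 2 = sigma * ((theta ^ 2 - reflect theta ^ 2) * theta_recip ^ 2)"
    by (simp only: power2_eq_square[of sigma] sigma_eq[symmetric])
  also have "\<dots> = (theta ^ 2 - reflect theta ^ 2) ^ 2 * dilate theta_recip ^ 4 * (theta * theta_recip) ^ 2"
    unfolding sigma_eq' by (simp add: power2_eq_square[of "_ - _"] power_mult_distrib mult_ac)
  also have "\<dots> = dilate omega * (1 + sigma)"
    by (simp only: theta_square_diff_square dilate_omega one_plus_sigma)
  finally show ?thesis .
qed

lemma bisect_theta_nu: "bisect (theta * nu) = dilate theta * (2 * sigma)"
proof (rule even_part)
  have e: "theta * nu = theta ^ 2 * (theta - reflect theta) * dilate theta_recip ^ 2"
    unfolding nu_def by (subst theta_recip_eq) (simp add: power2_eq_square mult_ac)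
  \<comment> \<open>Symmetrising \<open>a^2 (a - b)\<close> in \<open>a\<close> and \<open>b\<close>
    gives \<open>(a - b)^2 (a + b)\<close>.\<close>
  have "theta * nu + reflect (theta * nu) =
      (theta - reflect theta) ^ 2 * (theta + reflect theta) * dilate theta_recip ^ 2"
    unfolding e by (simp add: power2_eq_square algebra_simps)
  also have "\<dots> = 2 * dilate (dilate theta * (2 * sigma))"
    unfolding theta_diff_square theta_add_reflect by (simp add: sigma_def mult_ac)
  finally show "theta * nu + reflect (theta * nu) = 2 * dilate (dilate theta * (2 * sigma))" .
qed

text \<open>Over the common denominator \<phi>(-q^2)^4, symmetrising \<sigma> produces the square of
  \<phi>(q)^2 - \<phi>(-q)^2, which is a series in \<open>q^2\<close>.\<close>

lemma bisect_sigma: "2 * bisect sigma = omega"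
proof -
  have "2 * dilate (2 * bisect sigma) = 2 * (sigma + reflect sigma)"
    by (simp add: even_part')
  also have "sigma + reflect sigma = (theta ^ 2 - reflect theta ^ 2) ^ 2 * dilate theta_recip ^ 4"
    unfolding sigma_eq' by (simp add: power2_eq_square[of "_ - _"] algebra_simps)
  also have "\<dots> = dilate omega"
    by (simp only: theta_square_diff_square dilate_omega)
  finally have "dilate (2 * bisect sigma) = dilate omega"
    by (metis mult_left_cancel zero_neq_numeral)
  thus ?thesis
    by (rule dilate_inject)
qed

section \<open>Rings stable under bisection\<close>

text \<open>By \<open>nu_square\<close> this is the ring generated by \<sigma>(q^2) and \<nu>; the
  form linear in \<nu> lets \<open>bisect\<close> act coefficient by coefficient.\<close>

definition nu_module :: "int fps set"
  where "nu_module = {dilate a + dilate b * nu | a b. a \<in> ring_gen sigma \<and> b \<in> ring_gen sigma}"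

lemma nu_module_mult:
  assumes "f \<in> nu_module" "g \<in> nu_module"
  shows "f * g \<in> nu_module"
proof -
  obtain a b c d where f: "f = dilate a + dilate b * nu" and g: "g = dilate c + dilate d * nu"
    and mem: "a \<in> ring_gen sigma" "b \<in> ring_gen sigma" "c \<in> ring_gen sigma" "d \<in> ring_gen sigma"
    using assms unfolding nu_module_def by blast
  have "f * g = dilate (a * c) + dilate (a * d + b * c) * nu + dilate (b * d) * nu ^ 2"
    by (simp add: f g power2_eq_square algebra_simps)
  also have "\<dots> = dilate (a * c + 2 * sigma * b * d) + dilate (a * d + b * c + 2 * sigma * b * d) * nu"
    unfolding nu_square by (simp add: algebra_simps)
  finally have "f * g = dilate (a * c + 2 * sigma * b * d) + dilate (a * d + b * c + 2 * sigma * b * d) * nu" .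
  moreover have "a * c + 2 * sigma * b * d \<in> ring_gen sigma" "a * d + b * c + 2 * sigma * b * d \<in> ring_gen sigma"
    by (intro ring_gen_closed mem)+
  ultimately show ?thesis
    unfolding nu_module_def by blast
qed

text \<open>Squaring the quadratic equation of \<open>u = 1 + nu\<close> and reducing once more
  expresses \<open>u^4 - 1\<close> as 4 times an element linear in \<open>u\<close>; the definition
  of \<omega> supplies another 4.\<close>

lemma omega_eq: "\<exists>h\<in>nu_module. omega = 16 * h"
proof -
  define t where "t = 1 + sigma"
  \<comment> \<open>With \<open>t\<close> at \<open>q^2\<close>,
    \<open>4 t^2 (2 t u - 1) - 4 t u\<close> has \<open>u\<close>-coefficient
    \<open>8 t^3 - 4 t = 4 b\<close>.\<close>
  define b where "b = 2 * t ^ 3 - t"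
  have sq: "(1 + nu) ^ 2 = 2 * dilate t * (1 + nu) - 1"
    using nu_square by (simp add: t_def power2_eq_square algebra_simps)
  have "(1 + nu) ^ 4 = ((1 + nu) ^ 2) ^ 2"
    by (simp flip: power_mult)
  also have "\<dots> = (2 * dilate t * (1 + nu) - 1) ^ 2"
    by (simp only: sq)
  also have "\<dots> = 4 * dilate t ^ 2 * (1 + nu) ^ 2 - 4 * dilate t * (1 + nu) + 1"
    by (simp add: power2_eq_square algebra_simps)
  also have "\<dots> = 4 * dilate b * (1 + nu) - 4 * dilate t ^ 2 + 1"
    unfolding sq by (simp add: b_def power2_eq_square power3_eq_cube algebra_simps)
  finally have u4: "(1 + nu) ^ 4 = 4 * dilate b * (1 + nu) - 4 * dilate t ^ 2 + 1" .
  have "omega = 16 * (dilate (b - t ^ 2) + dilate b * nu)"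
    unfolding omega_def one_plus_nu[symmetric] u4 by (simp add: algebra_simps)
  moreover have "t \<in> ring_gen sigma"
    unfolding t_def by (intro ring_gen_closed)
  hence "b \<in> ring_gen sigma" "b - t ^ 2 \<in> ring_gen sigma"
    unfolding b_def by (intro ring_gen_closed; assumption)+
  ultimately show ?thesis
    unfolding nu_module_def by blast
qed

lemma nu_module_one: "1 \<in> nu_module"
proof -
  have "1 = dilate 1 + dilate 0 * nu"
    by simp
  thus ?thesis
    unfolding nu_module_def using ring_gen.one ring_gen_0 by blast
qed

lemma nu_module_diff:
  assumes "f \<in> nu_module" "g \<in> nu_module"
  shows "f - g \<in> nu_module"
proof -
  obtain a b c d where f: "f = dilate a + dilate b * nu" and g: "g = dilate c + dilate d * nu"
    and mem: "a \<in> ring_gen sigma" "b \<in> ring_gen sigma" "c \<in> ring_gen sigma" "d \<in> ring_gen sigma"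
    using assms unfolding nu_module_def by blast
  have "f - g = dilate (a - c) + dilate (b - d) * nu"
    by (simp add: f g algebra_simps)
  moreover have "a - c \<in> ring_gen sigma" "b - d \<in> ring_gen sigma"
    by (intro ring_gen_closed mem)+
  ultimately show ?thesis
    unfolding nu_module_def by blast
qed

lemma nu_module_add:
  assumes "f \<in> nu_module" "g \<in> nu_module"
  shows "f + g \<in> nu_module"
proof -
  have "f + g = f - (1 - 1 - g)"
    by simp
  thus ?thesis
    using assms by (metis nu_module_diff nu_module_one)
qed

lemma nu_module_numeral: "numeral k \<in> nu_module"
  by (induction k) (auto intro: nu_module_one nu_module_add simp only: numeral.simps)

lemma ring_gen_omega_nu_module: "f \<in> ring_gen omega \<Longrightarrow> f \<in> nu_module"
proof (induction rule: ring_gen.induct)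
  case (mult_gen a)
  obtain h where "h \<in> nu_module" "omega = 16 * h"
    using omega_eq by blast
  thus ?case
    using mult_gen by (metis nu_module_mult nu_module_numeral)
qed (auto intro: nu_module_one nu_module_diff)

text \<open>By \<open>sigma_square\<close>, \<sigma> is quadratic over the polynomials in
  \<omega>(q^2), so every power of it reduces to degree at most 1.\<close>

lemma ring_gen_sigma_split:
  assumes "f \<in> ring_gen sigma"
  shows "\<exists>a\<in>ring_gen omega. \<exists>b\<in>ring_gen omega. f = dilate a + dilate b * sigma"
  using assms
proof induction
  case one
  have "1 = dilate 1 + dilate 0 * sigma"
    by simp
  thus ?case
    using ring_gen.one ring_gen_0 by blast
next
  case (diff f g)
  then obtain a b c d where mem: "a \<in> ring_gen omega" "b \<in> ring_gen omega" "c \<in> ring_gen omega" "d \<in> ring_gen omega"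
    and "f = dilate a + dilate b * sigma" "g = dilate c + dilate d * sigma"
    by blast
  hence "f - g = dilate (a - c) + dilate (b - d) * sigma"
    by (simp add: algebra_simps)
  thus ?case
    using mem by (blast intro: ring_gen.diff)
next
  case (mult_gen f)
  then obtain a b where mem: "a \<in> ring_gen omega" "b \<in> ring_gen omega"
    and f: "f = dilate a + dilate b * sigma"
    by blast
  have "sigma * f = dilate a * sigma + dilate b * sigma ^ 2"
    by (simp add: f power2_eq_square algebra_simps)
  also have "\<dots> = dilate (omega * b) + dilate (a + omega * b) * sigma"
    unfolding sigma_square by (simp add: algebra_simps)
  finally show ?case
    using mem by (blast intro: ring_gen.mult_gen ring_gen_add)
qed

lemma bisect_theta_nu_module:
  assumes "f \<in> nu_module"
  shows "\<exists>g\<in>ring_gen sigma. bisect (theta * f) = dilate theta * g"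
proof -
  obtain a b where f: "f = dilate a + dilate b * nu"
    and mem: "a \<in> ring_gen sigma" "b \<in> ring_gen sigma"
    using assms unfolding nu_module_def by blast
  have e: "theta * f = dilate a * theta + dilate b * (theta * nu)"
    by (simp add: f algebra_simps)
  have "bisect (theta * f) = dilate theta * (a + 2 * sigma * b)"
    unfolding e bisect_ring bisect_dilate_mult bisect_theta bisect_theta_nu by (simp add: algebra_simps)
  moreover have "a + 2 * sigma * b \<in> ring_gen sigma"
    by (intro ring_gen_closed mem)
  ultimately show ?thesis
    by blast
qed

lemma bisect_dilate_theta_ring_gen:
  assumes "f \<in> ring_gen sigma"
  shows "\<exists>g\<in>ring_gen omega. 2 * bisect (dilate theta * f) = theta * g"
proof -
  obtain a b where mem: "a \<in> ring_gen omega" "b \<in> ring_gen omega" and f: "f = dilate a + dilate b * sigma"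
    using ring_gen_sigma_split[OF assms] by blast
  have "2 * bisect (dilate theta * f) = theta * (2 * a + b * (2 * bisect sigma))"
    unfolding f bisect_dilate_mult bisect_ring bisect_dilate by (simp add: algebra_simps)
  moreover have "2 * a + b * omega \<in> ring_gen omega"
    by (intro ring_gen_closed mem)
  ultimately show ?thesis
    unfolding bisect_sigma by blast
qed

lemma theta_recip_nth_0: "theta_recip $ 0 = 1"
  using arg_cong[OF theta_recip, of "\<lambda>f. f $ 0"] by (simp add: reflect_nth)

lemma omega_nth_0: "omega $ 0 = 0"
  by (simp add: omega_def theta_recip_nth_0 fps_nth_power_0 numeral_fps_const)

text \<open>The factor 16 in \<open>omega_eq\<close> loses only one factor 2 to \<open>bisect_sigma\<close>.\<close>

lemma bisect_bisect_theta_omega: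
  assumes "f \<in> ring_gen omega"
  shows "\<exists>g\<in>ring_gen omega. bisect (bisect (theta * (omega * f))) = 8 * (theta * (omega * g))"
proof -
  obtain h where h: "h \<in> nu_module" "omega = 16 * h"
    using omega_eq by blast
  have "h * f \<in> nu_module"
    using h(1) ring_gen_omega_nu_module[OF assms] by (rule nu_module_mult)
  then obtain c where c: "c \<in> ring_gen sigma" "bisect (theta * (h * f)) = dilate theta * c"
    using bisect_theta_nu_module by blast
  obtain g where g: "g \<in> ring_gen omega" "2 * bisect (dilate theta * c) = theta * g"
    using bisect_dilate_theta_ring_gen[OF c(1)] by blast
  have e: "theta * (omega * f) = 16 * (theta * (h * f))"
    by (simp add: h(2))
  have *: "bisect (bisect (theta * (omega * f))) = 8 * (theta * g)"
    unfolding e by (simp add: c(2) flip: g(2))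
  \<comment> \<open>Bisection keeps the coefficient at 0, so \<open>g\<close> has none either and
    regains the factor \<omega> needed for iteration.\<close>
  have "(bisect (bisect (theta * (omega * f)))) $ 0 = 0"
    by (simp add: omega_nth_0)
  hence "g $ 0 = 0"
    unfolding * by (simp add: numeral_fps_const)
  then obtain g' where "g' \<in> ring_gen omega" "g = omega * g'"
    using ring_gen_split_const[OF g(1) omega_nth_0] by auto
  with * show ?thesis
    by blast
qed

text \<open>Nonconstant coefficients of \<phi> are even and \<phi>(q) - \<phi>(-q) is twice its odd
  part, so \<nu> = 4x. Expanding \<open>4 * ((1 + 4 * x) ^ 4 - 1)\<close> gives the factor
  64.\<close>

lemma omega_dvd: "64 dvd omega"
proof -
  define T :: "int fps" where "T = Abs_fps (\<lambda>n. if n = 0 then 0 else theta $ n div 2)"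
  have "even (theta $ n :: int)" if "n \<noteq> 0" for n
    by (cases "\<exists>m. n = m ^ 2") (use that in \<open>auto simp: theta_nth_square theta_nth_nonsquare\<close>)
  hence T: "theta = 1 + 2 * T"
    by (intro fps_ext) (simp add: T_def numeral_fps_const)
  have "theta - reflect theta = 2 * (2 * T - (T + reflect T))"
    by (simp add: T)
  also have "\<dots> = 4 * (T - dilate (bisect T))"
    unfolding even_part' by simp
  finally obtain x where x: "nu = 4 * x"
    unfolding nu_def by (metis mult.assoc)
  have "omega = 64 * (x + 6 * x ^ 2 + 16 * x ^ 3 + 16 * x ^ 4)"
    unfolding omega_def one_plus_nu[symmetric] x
    by (simp add: power2_eq_square power3_eq_cube power4_eq_xxxx algebra_simps)
  thus ?thesis
    by (rule dvdI)
qed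

text \<open>The first double bisection produces \<phi> (1 + \<omega>) with no power of 8; each later
  one fixes \<phi> and contributes a factor 8.\<close>

lemma bisect_bisect_iterate:
  "\<exists>f\<in>ring_gen omega. ((bisect \<circ> bisect) ^^ Suc k) (theta ^ 2 * theta_recip) =
    theta + 8 ^ k * (theta * (omega * f))"
proof (induction k)
  case 0
  have e': "theta ^ 2 * theta_recip = theta + theta * nu"
    using one_plus_nu by (metis distrib_left mult.assoc mult_1_right power2_eq_square)
  have e: "bisect (theta ^ 2 * theta_recip) = dilate theta * (1 + 2 * sigma)"
    unfolding e' bisect_ring bisect_theta bisect_theta_nu by (simp add: algebra_simps)
  have bisect_1: "bisect 1 = (1 :: int fps)"
    by (metis bisect_dilate dilate_ring_hom(5))
  have "bisect (bisect (theta ^ 2 * theta_recip)) = theta + theta * (omega * 1)"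
    unfolding e bisect_dilate_mult bisect_ring bisect_sigma bisect_1 by (simp add: algebra_simps)
  thus ?case
    using ring_gen.one by auto
next
  case (Suc k)
  then obtain f where f: "f \<in> ring_gen omega"
    "((bisect \<circ> bisect) ^^ Suc k) (theta ^ 2 * theta_recip) = theta + 8 ^ k * (theta * (omega * f))"
    by blast
  obtain g where g: "g \<in> ring_gen omega" "bisect (bisect (theta * (omega * f))) = 8 * (theta * (omega * g))"
    using bisect_bisect_theta_omega[OF f(1)] by blast
  have "((bisect \<circ> bisect) ^^ Suc (Suc k)) (theta ^ 2 * theta_recip) =
      bisect (bisect (theta + 8 ^ k * (theta * (omega * f))))"
    using f(2) by simp
  also have "\<dots> = theta + 8 ^ Suc k * (theta * (omega * g))"
    unfolding bisect_ring bisect_theta bisect_dilate g(2) by simp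
  finally show ?case
    using g(1) by blast
qed

lemma bisect_bisect_iterate_nth: "((bisect \<circ> bisect) ^^ k) f $ n = f $ (4 ^ k * n)"
  by (induction k arbitrary: n) (simp_all add: mult_ac)

theorem theorem1p1:
  fixes n \<alpha> :: nat
  assumes "\<alpha> > 0"
  shows "[v0 (2 ^ (2 * \<alpha> + 2) * n) = (if \<exists>k::int. int n = k ^ 2 then 1 else 0)] (mod 2 ^ (3 * \<alpha> + 2))"
proof -
  obtain k where k: "\<alpha> = Suc k"
    using assms by (cases \<alpha>) auto
  let ?W = "2 * bisect (bisect (Abs_fps v0)) - 1"
  have "?W = ?W * reflect theta * theta_recip"
    by (simp add: theta_recip mult.assoc)
  hence W: "?W = theta ^ 2 * theta_recip"
    by (simp only: bisect_bisect_v0)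
  obtain f where f: "((bisect \<circ> bisect) ^^ \<alpha>) ?W = theta + 8 ^ k * (theta * (omega * f))"
    unfolding W k using bisect_bisect_iterate by blast
  obtain u where u: "omega = 64 * u"
    using omega_dvd by blast
  \<comment> \<open>The exponent is \<open>3 k + 6 = 3 \<alpha> + 3\<close>; the surplus 2 cancels
    against the 2 in front of \<open>v0\<close>.\<close>
  have e: "(8::int) ^ k * 64 = 2 * 2 ^ (3 * \<alpha> + 2)"
    by (simp add: k power_add power_mult)
  have index: "(2::nat) ^ (2 * \<alpha> + 2) * n = 2 * (2 * (4 ^ \<alpha> * n))"
    by (simp add: power_add power_mult)
  have "2 * v0 (2 ^ (2 * \<alpha> + 2) * n) - (if n = 0 then 1 else 0) = ((bisect \<circ> bisect) ^^ \<alpha>) ?W $ n"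
    unfolding index by (simp add: bisect_bisect_iterate_nth numeral_fps_const)
  also have "\<dots> = theta $ n + 8 ^ k * (64 * (theta * (u * f)) $ n)"
  proof -
    have e': "8 ^ k * (theta * (omega * f)) = fps_const (8 ^ k * 64) * (theta * (u * f))"
      by (simp add: u numeral_fps_const fps_const_power mult_ac)
    show ?thesis
      unfolding f fps_add_nth e' fps_mult_left_const_nth by simp
  qed
  also have "\<dots> = theta $ n + 2 * 2 ^ (3 * \<alpha> + 2) * (theta * (u * f)) $ n"
    by (simp only: e mult.assoc[symmetric])
  \<comment> \<open>The correction at \<open>n = 0\<close> is the same as the one caused by the
    \<open>- 1\<close> in \<open>?W\<close>, so both drop out.\<close>
  also have "theta $ n = 2 * (if \<exists>k::int. int n = k ^ 2 then 1 else 0) - (if n = 0 then 1 else 0 :: int)"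
  proof (cases "\<exists>m. n = m ^ 2")
    case True
    then obtain m where m: "n = m ^ 2" ..
    hence "\<exists>k::int. int n = k ^ 2"
      by (metis of_nat_power)
    thus ?thesis
      by (simp add: theta_nth_square m)
  next
    case False
    have "\<nexists>k::int. int n = k ^ 2"
    proof
      assume "\<exists>k::int. int n = k ^ 2"
      then obtain k :: int where "int n = k ^ 2" ..
      hence "int n = int (nat \<bar>k\<bar> ^ 2)"
        by simp
      with False show False
        by (metis of_nat_eq_iff)
    qed
    moreover have "n \<noteq> 0"
      using False by (metis power_zero_numeral)
    ultimately show ?thesis
      by (simp add: theta_nth_nonsquare[OF False])
  qed
  finally have "v0 (2 ^ (2 * \<alpha> + 2) * n) = (if \<exists>k::int. int n = k ^ 2 then 1 else 0)
      + 2 ^ (3 * \<alpha> + 2) * (theta * (u * f)) $ n"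
    by simp
  thus ?thesis
    by (simp add: cong_iff_dvd_diff)
qed

end
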